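(* Let $b>0$ be a real number, let $m \in \mathbb{N}$, and let $P(x) = \sum_{j=0}^{p} a_{j}x^{j}$ be a polynomial. Then $$I(P;b,m) := \int_{0}^{b} P(x) \ln^{m}x \, dx = \sum_{k=0}^{m} (-1)^{k}\, k! \binom{m}{k} \ln^{m-k}b \, \sum_{j=0}^{p} a_{j} \frac{b^{j+1}}{(j+1)^{k+1}}.$$ In particular, $I(P;b,m)$ is a linear combination of the terms $b^{j} \ln^{k}b$ with $1 \leq j \leq 1+p$ and $0 \leq k \leq m$.
   Context: Here $\ln^{m} x$ means $(\ln x)^{m}$, with the convention $\ln^{0} x = 1$. The coefficients $a_j$ are constants (real numbers), $p$ is the degree of $P$, and the linear combination has coefficients not depending on $b$. *)

theory Defs
  imports "HOL-Analysis.Analysis" "HOL-Computational_Algebra.Polynomial"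
begin

(* The gauge (Henstock-Kurzweil) integral agrees with the improper Riemann integral here; the
   value of the integrand at 0 is irrelevant, as a point is negligible. If the integrand were
   not integrable the value would be a dummy, so integrability must be claimed separately. *)
definition log_integral :: "real poly \<Rightarrow> real \<Rightarrow> nat \<Rightarrow> real" where
  "log_integral P b m = integral {0..b} (\<lambda>x. poly P x * ln x ^ m)"

end

theory Submission imports Defs begin

text \<open>
  By linearity it suffices to integrate the monomials \<open>x ^ j * ln x ^ m\<close>. Write \<open>n = j + 1\<close>.
  The function \<open>x ^ n / n * ln x ^ (m + 1)\<close> has derivative
  \<open>x ^ j * ln x ^ (m + 1) + (m + 1) / n * (x ^ j * ln x ^ m)\<close> for positive \<open>x\<close>, and it extends
  continuously by \<open>0\<close> to the origin, since powers of \<open>x\<close> dominate powers of \<open>ln x\<close>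
  (\<open>tendsto_power_mult_ln_power_0\<close>). The fundamental theorem of calculus on \<open>[0, b]\<close>, which asks
  for the derivative only at interior points, thus turns integrability of
  \<open>x ^ j * ln x ^ m\<close> into that of \<open>x ^ j * ln x ^ (m + 1)\<close> and links the two integrals by
  \[ I (m + 1) = \frac{b ^ n \ln^{m+1} b}{n} - \frac{m + 1}{n} I (m). \]
  The closed form satisfies the same recursion (\<open>monomial_log_closed_form_Suc\<close>), because
  \<open>(k + 1)! * (m + 1 choose k + 1) = (m + 1) * k! * (m choose k)\<close>. The coefficients of the linear
  combination are read off the closed form after the substitution of \<open>m - k\<close> for \<open>k\<close>.
\<close>

text \<open>
  With \<open>t = - ln x\<close> this is the fact that \<open>exp t\<close> outgrows every power of \<open>t\<close>; one factor of
  \<open>x\<close> absorbs the logarithms and the other factors stay bounded.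
\<close>

lemma tendsto_power_mult_ln_power_0:
  "((\<lambda>x::real. x ^ Suc j * ln x ^ m) \<longlongrightarrow> 0) (at_right 0)"
proof -
  have "filterlim (\<lambda>x::real. - ln x) at_top (at_right 0)"
    using ln_at_0 by (simp add: filterlim_uminus_at_top)
  from filterlim_compose[OF tendsto_power_div_exp_0[of m] this]
  have "((\<lambda>x::real. (- ln x) ^ m / exp (- ln x)) \<longlongrightarrow> 0) (at_right 0)" .
  then have "((\<lambda>x::real. x ^ j * (-1) ^ m * ((- ln x) ^ m / exp (- ln x))) \<longlongrightarrow> 0 ^ j * (-1) ^ m * 0)
      (at_right 0)"
    by (intro tendsto_intros)
  moreover have "\<forall>\<^sub>F x::real in at_right 0.
      x ^ j * (-1) ^ m * ((- ln x) ^ m / exp (- ln x)) = x ^ Suc j * ln x ^ m"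
    using eventually_at_right_less[of 0]
  proof eventually_elim
    case (elim x)
    have "(-1) ^ m * (- ln x) ^ m = ln x ^ m"
      by (simp flip: power_mult_distrib)
    then show ?case
      using elim by (simp add: exp_minus field_simps)
  qed
  ultimately show ?thesis
    by (simp add: tendsto_cong)
qed

text \<open>
  At the origin the function takes the value of its limit \<open>0\<close>, since the exponent of \<open>x\<close> is
  positive; whatever value \<open>ln 0\<close> has is multiplied by \<open>0\<close>.
\<close>

lemma continuous_on_power_mult_ln_power:
  "continuous_on {0..b} (\<lambda>x::real. x ^ Suc j * ln x ^ m)"
proof (rule continuous_on_eq_continuous_within[THEN iffD2], rule ballI)
  fix x :: real assume x: "x \<in> {0..b}"
  show "continuous (at x within {0..b}) (\<lambda>x. x ^ Suc j * ln x ^ m)"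
  proof (cases "x = 0")
    case True
    have "((\<lambda>x::real. x ^ Suc j * ln x ^ m) \<longlongrightarrow> 0) (at 0 within {0..b})"
      using tendsto_power_mult_ln_power_0
      by (rule tendsto_mono[rotated])
        (auto simp: le_filter_def eventually_at_filter elim!: eventually_mono)
    then show ?thesis
      using True by (simp add: continuous_within)
  next
    case False
    then show ?thesis
      using x by (intro continuous_at_imp_continuous_at_within[OF isCont_mult]
          isCont_power isCont_ln continuous_ident) auto
  qed
qed

definition monomial_log_closed_form :: "nat \<Rightarrow> nat \<Rightarrow> real \<Rightarrow> real" where
  "monomial_log_closed_form j m b =
    (\<Sum>k=0..m. (-1) ^ k * fact k * real (m choose k) * ln b ^ (m - k) *
      (b ^ Suc j / real (Suc j) ^ Suc k))"

text \<open>
  The term \<open>k = 0\<close> is the boundary term of the integration by parts, and the term \<open>k + 1\<close> is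
  \<open>- (m + 1) / (j + 1)\<close> times the term \<open>k\<close> of the sum for \<open>m\<close>.
\<close>

lemma monomial_log_closed_form_Suc:
  "monomial_log_closed_form j (Suc m) b =
    b ^ Suc j * ln b ^ Suc m / real (Suc j)
      - real (Suc m) / real (Suc j) * monomial_log_closed_form j m b"
proof -
  have shift: "(-1) ^ Suc k * fact (Suc k) * real (Suc m choose Suc k) * ln b ^ (Suc m - Suc k) *
        (b ^ Suc j / real (Suc j) ^ Suc (Suc k)) =
      - (real (Suc m) / real (Suc j)) * ((-1) ^ k * fact k * real (m choose k) * ln b ^ (m - k) *
        (b ^ Suc j / real (Suc j) ^ Suc k))" for k
  proof -
    have "real (Suc k) * real (Suc m choose Suc k) = real (Suc m) * real (m choose k)"
      using Suc_times_binomial[of k m] by (metis of_nat_mult)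
    then have binom: "fact (Suc k) * real (Suc m choose Suc k)
        = real (Suc m) * (fact k * real (m choose k))"
      by (simp only: fact_Suc mult_ac)
    have "(-1) ^ Suc k * fact (Suc k) * real (Suc m choose Suc k) * ln b ^ (Suc m - Suc k) *
          (b ^ Suc j / real (Suc j) ^ Suc (Suc k)) =
        - ((-1) ^ k * (fact (Suc k) * real (Suc m choose Suc k)) * ln b ^ (m - k) *
          (b ^ Suc j / (real (Suc j) * real (Suc j) ^ Suc k)))"
      by (simp del: fact_Suc binomial_Suc_Suc of_nat_Suc)
    also have "\<dots> = - (real (Suc m) / real (Suc j)) *
        ((-1) ^ k * fact k * real (m choose k) * ln b ^ (m - k) * (b ^ Suc j / real (Suc j) ^ Suc k))"
      unfolding binom by (simp del: of_nat_Suc)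
    finally show ?thesis .
  qed
  show ?thesis
    unfolding monomial_log_closed_form_def sum.atLeast0_atMost_Suc_shift comp_def shift
      sum_distrib_left[symmetric] by simp
qed

lemma has_integral_power_mult_ln_power:
  assumes "b > 0"
  shows "((\<lambda>x. x ^ j * ln x ^ m) has_integral monomial_log_closed_form j m b) {0..b}"
proof (induction m)
  case 0
  have "((\<lambda>x. x ^ j) has_integral b ^ Suc j / real (Suc j) - 0 ^ Suc j / real (Suc j)) {0..b}"
    using assms
    by (intro fundamental_theorem_of_calculus)
      (auto intro!: derivative_eq_intros simp flip: has_real_derivative_iff_has_vector_derivative
        simp del: of_nat_Suc power_Suc)
  then show ?case
    by (simp add: monomial_log_closed_form_def)
next
  case (Suc m)
  define n where "n = real (Suc j)"
  have "n > 0" by (simp add: n_def)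
  \<comment> \<open>\<open>G\<close> is the boundary term of the integration by parts; it vanishes at \<open>0\<close>.\<close>
  define G where "G = (\<lambda>x. x ^ Suc j * ln x ^ Suc m / n)"
  have "((\<lambda>x. x ^ j * ln x ^ Suc m + real (Suc m) / n * (x ^ j * ln x ^ m)) has_integral
      G b - G 0) {0..b}"
  proof (rule fundamental_theorem_of_calculus_interior)
    show "continuous_on {0..b} G"
      unfolding G_def using \<open>n > 0\<close>
      by (intro continuous_on_divide continuous_on_power_mult_ln_power continuous_on_const) auto
    fix x :: real assume "x \<in> {0<..<b}"
    then have "x > 0" by simp
    have "(G has_real_derivative
        (n * x ^ j * ln x ^ Suc m + x ^ Suc j * (real (Suc m) * ln x ^ m * (1 / x))) / n) (at x)"
      unfolding G_def using \<open>x > 0\<close> \<open>n > 0\<close>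
      by (auto intro!: derivative_eq_intros simp: n_def simp del: of_nat_Suc power_Suc)
    moreover have "(n * x ^ j * ln x ^ Suc m + x ^ Suc j * (real (Suc m) * ln x ^ m * (1 / x))) / n =
        x ^ j * ln x ^ Suc m + real (Suc m) / n * (x ^ j * ln x ^ m)"
      using \<open>x > 0\<close> \<open>n > 0\<close> by (simp add: field_simps)
    ultimately show "(G has_vector_derivative
        x ^ j * ln x ^ Suc m + real (Suc m) / n * (x ^ j * ln x ^ m)) (at x)"
      by (simp only: has_real_derivative_iff_has_vector_derivative)
  qed (use assms in simp)
  from has_integral_diff[OF this has_integral_mult_right[OF Suc.IH, of "real (Suc m) / n"]]
  show ?case
    by (simp add: monomial_log_closed_form_Suc G_def n_def del: of_nat_Suc)
qed

lemma has_integral_poly_mult_ln_power: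
  assumes "b > 0"
  shows "((\<lambda>x. poly P x * ln x ^ m) has_integral
    (\<Sum>j=0..degree P. coeff P j * monomial_log_closed_form j m b)) {0..b}"
proof -
  have "((\<lambda>x. \<Sum>j=0..degree P. coeff P j * (x ^ j * ln x ^ m)) has_integral
      (\<Sum>j=0..degree P. coeff P j * monomial_log_closed_form j m b)) {0..b}"
    by (intro has_integral_sum has_integral_mult_right has_integral_power_mult_ln_power assms) simp
  then show ?thesis
    by (simp add: poly_altdef sum_distrib_right mult.assoc atLeast0AtMost)
qed

theorem theorem2p1:
  fixes P :: "real poly" and m :: nat
  shows "(\<forall>b::real. b > 0 \<longrightarrow>
            (\<lambda>x. poly P x * ln x ^ m) integrable_on {0..b} \<and>
            log_integral P b m =
              (\<Sum>k=0..m. (-1) ^ k * fact k * real (m choose k) * ln b ^ (m - k) *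
                 (\<Sum>j=0..degree P. coeff P j * (b ^ (j + 1) / real (j + 1) ^ (k + 1))))) \<and>
         (\<exists>c :: nat \<Rightarrow> nat \<Rightarrow> real. \<forall>b::real. b > 0 \<longrightarrow>
            log_integral P b m =
              (\<Sum>j=1..1 + degree P. \<Sum>k=0..m. c j k * (b ^ j * ln b ^ k)))"
proof (intro conjI allI impI exI)
  fix b :: real assume b: "b > 0"
  note int = has_integral_poly_mult_ln_power[OF b, of P m]
  show "(\<lambda>x. poly P x * ln x ^ m) integrable_on {0..b}"
    using int by blast
  have "log_integral P b m = (\<Sum>j=0..degree P. coeff P j * monomial_log_closed_form j m b)"
    unfolding log_integral_def using int by (rule integral_unique)
  also have "\<dots> = (\<Sum>k=0..m. (-1) ^ k * fact k * real (m choose k) * ln b ^ (m - k) *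
      (\<Sum>j=0..degree P. coeff P j * (b ^ (j + 1) / real (j + 1) ^ (k + 1))))"
    unfolding monomial_log_closed_form_def sum_distrib_left Suc_eq_plus1
    by (subst sum.swap) (simp only: mult_ac)
  finally show "log_integral P b m = (\<Sum>k=0..m. (-1) ^ k * fact k * real (m choose k) *
      ln b ^ (m - k) * (\<Sum>j=0..degree P. coeff P j * (b ^ (j + 1) / real (j + 1) ^ (k + 1))))" .
next
  fix b :: real assume b: "b > 0"
  let ?c = "\<lambda>j k. coeff P (j - 1) * ((-1) ^ (m - k) * fact (m - k) * real (m choose (m - k)) /
    real j ^ Suc (m - k))"
  \<comment> \<open>The coefficients are indexed by the exponent of \<open>ln b\<close>, so the sum is traversed backwards.\<close>
  have rev: "monomial_log_closed_form j m b = (\<Sum>k=0..m. (-1) ^ (m - k) * fact (m - k) *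
      real (m choose (m - k)) / real (Suc j) ^ Suc (m - k) * (b ^ Suc j * ln b ^ k))" for j
    unfolding monomial_log_closed_form_def
    by (subst sum.atLeastAtMost_rev) (rule sum.cong; simp)
  have "log_integral P b m = (\<Sum>j=0..degree P. coeff P j * monomial_log_closed_form j m b)"
    unfolding log_integral_def using has_integral_poly_mult_ln_power[OF b] by (rule integral_unique)
  also have "\<dots> = (\<Sum>j=0..degree P. \<Sum>k=0..m. ?c (Suc j) k * (b ^ Suc j * ln b ^ k))"
    unfolding rev sum_distrib_left by (simp only: diff_Suc_1 mult.assoc)
  also have "\<dots> = (\<Sum>j=1..1 + degree P. \<Sum>k=0..m. ?c j k * (b ^ j * ln b ^ k))"
    unfolding One_nat_def plus_nat.simps sum.shift_bounds_cl_Suc_ivl ..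
  finally show "log_integral P b m =
      (\<Sum>j=1..1 + degree P. \<Sum>k=0..m. ?c j k * (b ^ j * ln b ^ k))" .
qed

end
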